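(* Let $2\le k<n$. If $n$ is even and $S(n-2,k-2)$ is odd, then there does not exist a ucycle for the $k$-partitions of $[n]$.
   Context: $[m]=\{1,\dots,m\}$. A $k$-partition of $[n]$ is a partition of $[n]$ into exactly $k$ nonempty parts; $S(n,k)$ (Stirling number of the second kind) is the number of these, with $S(m,0)=0$ for $m\ge 1$. A string $r_1\cdots r_n$ over the alphabet $[k]$ represents a $k$-partition $p$ of $[n]$ if $r_i=r_j$ iff $i,j$ lie in the same part of $p$. A ucycle for the $k$-partitions of $[n]$ is a cyclic string $a_1\cdots a_N$ over the alphabet $[k]$, $N=S(n,k)$, indices modulo $N$, such that each $k$-partition of $[n]$ is represented by exactly one of the windows $a_ia_{i+1}\cdots a_{i+n-1}$, $1\le i\le N$. *)

theory Defs
  imports Complex_Main "HOL-Library.Disjoint_Sets"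
begin

definition k_partitions :: "nat \<Rightarrow> nat \<Rightarrow> nat set set set" where
  "k_partitions n k = {p. partition_on {1..n} p \<and> card p = k}"

(* Defined by counting rather than by the recursion of HOL-Combinatorics.Stirling. *)
definition S :: "nat \<Rightarrow> nat \<Rightarrow> nat" where
  "S n k = card (k_partitions n k)"

(* A string r_1 ... r_n is a list, so the letter r_i is r ! (i - 1). *)
definition represents :: "nat \<Rightarrow> nat list \<Rightarrow> nat set set \<Rightarrow> bool" where
  "represents n r p \<longleftrightarrow> length r = n \<and>
     (\<forall>i\<in>{1..n}. \<forall>j\<in>{1..n}.
        r ! (i - 1) = r ! (j - 1) \<longleftrightarrow> (\<exists>B\<in>p. i \<in> B \<and> j \<in> B))"

(* Starting positions count from 0; the index wraps around, also when n > length a. *)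
definition window :: "nat \<Rightarrow> nat list \<Rightarrow> nat \<Rightarrow> nat list" where
  "window n a i = map (\<lambda>j. a ! ((i + j) mod length a)) [0..<n]"

definition ucycle :: "nat \<Rightarrow> nat \<Rightarrow> nat list \<Rightarrow> bool" where
  "ucycle n k a \<longleftrightarrow> length a = S n k \<and> set a \<subseteq> {1..k} \<and>
     (\<forall>p\<in>k_partitions n k. \<exists>!i. i < S n k \<and> represents n (window n a i) p)"

end

theory Submission
  imports Defs "HOL-Combinatorics.Stirling"
begin

text \<open>
  Every window of a ucycle contains all \<open>k\<close> letters, so ordering the letters by recency (latest
  occurrence first) gives a permutation of \<open>{1..k}\<close>. Advancing by one position moves one letter,
  of rank \<open>r\<close> say (counted from 0), to the front, which is a permutation of sign \<open>(-1)^r\<close>.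
  Around the whole cycle the permutation returns to itself, so the ranks have an even sum. The rank
  depends only on the partition that the new window represents: if \<open>n\<close> is a singleton the rank
  is \<open>k - 1\<close>, and otherwise, for a fixed \<open>k\<close>-partition of \<open>[n-1]\<close>, adding \<open>n\<close> to the
  various parts yields each of the ranks \<open>0, \<dots>, k - 1\<close> once. Hence
  \<open>(k - 1) S(n-1, k-1) + (k choose 2) S(n-1, k)\<close> is even, which for even \<open>n\<close> contradicts
  the oddness of \<open>S(n-2, k-2)\<close> by the recurrence modulo 2.
\<close>

section \<open>Restricted growth words\<close>

text \<open>Words are stored with the last letter first, so that a word is extended by consing.\<close>

fun rgf :: "nat \<Rightarrow> nat \<Rightarrow> nat list set" where
  "rgf 0 0 = {[]}"
| "rgf 0 (Suc k) = {}"
| "rgf (Suc n) 0 = {}"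
| "rgf (Suc n) (Suc k) =
     (\<lambda>(x, u). x # u) ` ({..<Suc k} \<times> rgf n (Suc k)) \<union> (#) k ` rgf n k"

lemma rgf_length_set: "u \<in> rgf n k \<Longrightarrow> length u = n \<and> set u = {..<k}"
  by (induction n k arbitrary: u rule: rgf.induct) (fastforce simp: lessThan_Suc)+

lemma finite_rgf: "finite (rgf n k)"
  by (induction n k rule: rgf.induct) auto

text \<open>The tail uses the letters \<open>{..<Suc k}\<close> in the first set and only
  \<open>{..<k}\<close> in the second. Hence sums over \<open>rgf\<close> split along its
  recursion.\<close>

lemma rgf_disjoint:
  "(\<lambda>(x, u). x # u) ` ({..<Suc k} \<times> rgf n (Suc k)) \<inter> (#) k ` rgf n k = {}"
  by (auto dest!: rgf_length_set)

lemma sum_rgf_Suc: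
  "sum f (rgf (Suc n) (Suc k)) =
     (\<Sum>u\<in>rgf n (Suc k). \<Sum>x<Suc k. f (x # u)) + (\<Sum>u\<in>rgf n k. f (k # u))"
proof -
  have "sum f ((\<lambda>(x, u). x # u) ` ({..<Suc k} \<times> rgf n (Suc k))) =
      (\<Sum>(x, u)\<in>{..<Suc k} \<times> rgf n (Suc k). f (x # u))"
    by (subst sum.reindex) (auto simp: inj_on_def case_prod_unfold comp_def)
  also have "\<dots> = (\<Sum>u\<in>rgf n (Suc k). \<Sum>x<Suc k. f (x # u))"
    by (subst sum.cartesian_product [symmetric]) (rule sum.swap)
  finally have 1: "sum f ((\<lambda>(x, u). x # u) ` ({..<Suc k} \<times> rgf n (Suc k))) =
      (\<Sum>u\<in>rgf n (Suc k). \<Sum>x<Suc k. f (x # u))" .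
  have 2: "sum f ((#) k ` rgf n k) = (\<Sum>u\<in>rgf n k. f (k # u))"
    by (subst sum.reindex) (auto simp: inj_on_def)
  show ?thesis
    unfolding rgf.simps
    by (subst sum.union_disjoint) (use rgf_disjoint finite_rgf in \<open>auto simp only: 1 2 finite_imageI
      finite_cartesian_product finite_lessThan\<close>)
qed

lemma card_rgf: "card (rgf n k) = Stirling n k"
proof (induction n k rule: rgf.induct)
  case (4 n k)
  show ?case
    unfolding card_eq_sum sum_rgf_Suc using 4 by (simp add: card_eq_sum [symmetric])
qed auto

lemma ex_rgf_relabelling:
  "\<exists>f. inj_on f (set v) \<and> map f v \<in> rgf (length v) (card (set v))"
proof (induction v)
  case (Cons x v)
  then obtain f where f: "inj_on f (set v)" "map f v \<in> rgf (length v) (card (set v))"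
    by blast
  have im: "f ` set v = {..<card (set v)}"
    using rgf_length_set [OF f(2)] by simp
  show ?case
  proof (cases "x \<in> set v")
    case True
    then have "card (set v) \<noteq> 0"
      by auto
    then obtain c where c: "card (set v) = Suc c"
      by (cases "card (set v)") auto
    have "f x < Suc c"
      using im True c by auto
    then have "f x # map f v \<in> rgf (Suc (length v)) (Suc c)"
      using f(2) c by force
    then show ?thesis
      using f(1) True c by (intro exI [of _ f]) (simp add: insert_absorb del: rgf.simps)
  next
    case False
    let ?f = "f(x := card (set v))"
    have eq: "map ?f v = map f v"
      using False by auto
    have "inj_on ?f (set (x # v))"
    proof -
      have "card (set v) \<notin> f ` set v"
        by (simp add: im)
      then show ?thesis
        using inj_on_fun_updI[OF f(1)] False by (auto simp: inj_on_insert)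
    qed
    moreover have "map ?f (x # v) \<in> rgf (length (x # v)) (card (set (x # v)))"
      using f(2) False by (simp only: list.map eq) simp
    ultimately show ?thesis
      by blast
  qed
qed auto

text \<open>An injective renaming preserves the number of distinct letters of the tail, which
  decides whether the head is old or new; so both words arise from the same part of the recursion.
  An old head occurs in the tail, where \<open>f\<close> is the identity by induction; a new head is
  \<open>k\<close> in both words.\<close>

lemma rgf_relabelling_unique:
  assumes "u \<in> rgf n k" "map f u \<in> rgf n k" "inj_on f (set u)"
  shows "map f u = u"
  using assms
proof (induction n k arbitrary: u rule: rgf.induct)
  case (4 n k)
  obtain x v where u: "u = x # v"
    using 4(3) by auto
  from 4(3) consider
      (old) "x < Suc k" "v \<in> rgf n (Suc k)" | (new) "x = k" "v \<in> rgf n k"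
    by (auto simp: u)
  then show ?case
  proof cases
    case old
    then have "card (set v) = Suc k"
      using rgf_length_set by force
    moreover have "card (set (map f v)) = card (set v)"
      using 4(5) by (simp add: u card_image inj_on_def)
    ultimately have "map f v \<notin> rgf n k"
      using rgf_length_set by force
    then have "map f v \<in> rgf n (Suc k)"
      using 4(4) by (auto simp: u)
    then have "map f v = v"
      using 4(1)[of v] old 4(5) by (auto simp: u)
    moreover have "x \<in> set v"
      using old rgf_length_set by auto
    ultimately show ?thesis
      by (simp add: u map_idI) (metis in_set_conv_nth nth_map)
  next
    case new
    then have sv: "card (set v) = k"
      using rgf_length_set by force
    moreover have "card (set (map f v)) = card (set v)"
      using 4(5) by (simp add: u card_image inj_on_def)
    ultimately have "map f v \<notin> rgf n (Suc k)"
      using rgf_length_set by force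
    then have "map f v \<in> rgf n k" "f x = k"
      using 4(4) by (auto simp: u)
    moreover have "map f v = v"
      using 4(2)[of v] calculation new 4(5) by (auto simp: u)
    ultimately show ?thesis
      using new by (simp add: u)
  qed
qed auto

section \<open>Words representing partitions\<close>

lemma represents_nth_eq_iff:
  assumes "represents n r p" "i < n" "j < n"
  shows "r ! i = r ! j \<longleftrightarrow> (\<exists>B\<in>p. Suc i \<in> B \<and> Suc j \<in> B)"
proof -
  have "\<forall>i\<in>{1..n}. \<forall>j\<in>{1..n}. r ! (i - 1) = r ! (j - 1) \<longleftrightarrow> (\<exists>B\<in>p. i \<in> B \<and> j \<in> B)"
    using assms(1) unfolding represents_def by (rule conjunct2)
  from this [THEN bspec, of "Suc i", THEN bspec, of "Suc j"] show ?thesis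
    using assms(2,3) by simp
qed

lemma partition_on_same_part:
  "\<lbrakk>partition_on A p; B \<in> p; C \<in> p; x \<in> B; x \<in> C\<rbrakk> \<Longrightarrow> B = C"
  by (metis disjnt_iff disjointD disjoint_iff partition_onD2)

text \<open>Each part carries one letter: \<open>g\<close> is a bijection from \<open>p\<close> onto
  \<open>set r\<close>. By \<open>g_eq\<close>, it does not matter which position of a part is
  chosen.\<close>

lemma represents_card_set:
  assumes "p \<in> k_partitions n k" "represents n r p"
  shows "card (set r) = k"
proof -
  have po: "partition_on {1..n} p" "card p = k" and len: "length r = n"
    using assms by (auto simp: k_partitions_def represents_def)
  have rep: "r ! (i - 1) = r ! (j - 1) \<longleftrightarrow> (\<exists>B\<in>p. i \<in> B \<and> j \<in> B)"
    if "i \<in> {1..n}" "j \<in> {1..n}" for i j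
    using assms(2) that by (auto simp: represents_def)
  define g where "g B = r ! ((SOME i. i \<in> B) - 1)" for B :: "nat set"
  have some: "(SOME i. i \<in> B) \<in> B" if "B \<in> p" for B
    using po(1) that by (metis partition_onD3 some_in_eq)
  have sub: "B \<subseteq> {1..n}" if "B \<in> p" for B
    using po(1) that by (auto simp: partition_on_def)
  have g_eq: "g B = r ! (i - 1)" if "B \<in> p" "i \<in> B" for B i
  proof -
    have "\<exists>C\<in>p. (SOME i. i \<in> B) \<in> C \<and> i \<in> C"
      using some[OF that(1)] that by blast
    moreover have "(SOME i. i \<in> B) \<in> {1..n}" "i \<in> {1..n}"
      using sub[OF that(1)] some[OF that(1)] that(2) by blast+
    ultimately show ?thesis
      unfolding g_def using rep by blast
  qed
  have "inj_on g p"
  proof (rule inj_onI)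
    fix B C assume *: "B \<in> p" "C \<in> p" "g B = g C"
    obtain i j where ij: "i \<in> B" "j \<in> C"
      using some[OF *(1)] some[OF *(2)] by blast
    then have "r ! (i - 1) = r ! (j - 1)"
      using g_eq[OF *(1)] g_eq[OF *(2)] *(3) by simp
    moreover have "i \<in> {1..n}" "j \<in> {1..n}"
      using ij sub *(1,2) by blast+
    ultimately have "\<exists>D\<in>p. i \<in> D \<and> j \<in> D"
      using rep by blast
    then show "B = C"
      using partition_on_same_part[OF po(1)] ij *(1,2) by metis
  qed
  moreover have "g ` p = set r"
  proof (intro equalityI subsetI)
    fix c assume "c \<in> g ` p"
    then obtain B where B: "B \<in> p" "c = g B"
      by blast
    then have "(SOME i. i \<in> B) \<in> {1..n}"
      using some[OF B(1)] sub[OF B(1)] by blast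
    then have "(SOME i. i \<in> B) - 1 < length r"
      unfolding len atLeastAtMost_iff by linarith
    then show "c \<in> set r"
      unfolding B(2) g_def by (rule nth_mem)
  next
    fix c assume "c \<in> set r"
    then obtain i where i: "i < n" "c = r ! i"
      using len by (auto simp: in_set_conv_nth)
    then have "Suc i \<in> \<Union>p"
      using po(1) by (auto simp: partition_on_def)
    then obtain B where "B \<in> p" "Suc i \<in> B"
      by blast
    then have "c = g B"
      using g_eq[of B "Suc i"] i by simp
    then show "c \<in> g ` p"
      using \<open>B \<in> p\<close> by (rule image_eqI)
  qed
  ultimately show ?thesis
    using po(2) by (metis card_image)
qed

text \<open>A word fixes the relation of lying in the same part, and the parts are its
  classes.\<close>

lemma represents_unique_partition:
  assumes "partition_on {1..n} p" "partition_on {1..n} q" "represents n r p" "represents n r q"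
  shows "p = q"
proof -
  \<comment> \<open>Stated for fresh \<open>p\<close> and \<open>q\<close>, so that exchanging them
    gives the other inclusion.\<close>
  have "q \<subseteq> p"
    if pq: "partition_on {1..n} p" "partition_on {1..n} q" "represents n r p" "represents n r q"
    for p q
  proof
    fix B assume B: "B \<in> q"
    have rel: "(\<exists>B\<in>p. i \<in> B \<and> j \<in> B) \<longleftrightarrow> (\<exists>B\<in>q. i \<in> B \<and> j \<in> B)"
      if "i \<in> {1..n}" "j \<in> {1..n}" for i j
      using pq(3,4) that by (auto simp: represents_def)
    have sub: "C \<subseteq> {1..n}" if "C \<in> p \<union> q" for C
      using pq(1,2) that by (auto simp: partition_on_def)
    obtain i where i: "i \<in> B"
      using B pq(2) by (metis partition_onD3 all_not_in_conv)
    then have i': "i \<in> {1..n}"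
      using sub B by blast
    then obtain C where C: "C \<in> p" "i \<in> C"
      using pq(1) unfolding partition_on_def by blast
    have uniq: "D = B" if "D \<in> q" "i \<in> D" for D
      using partition_on_same_part[OF pq(2)] that B i by blast
    have uniq': "D = C" if "D \<in> p" "i \<in> D" for D
      using partition_on_same_part[OF pq(1)] that C by blast
    have "j \<in> B \<longleftrightarrow> j \<in> C" for j
    proof (cases "j \<in> {1..n}")
      case True
      then show ?thesis
        using rel[OF i' True] uniq uniq' B C i by blast
    next
      case False
      then show ?thesis
        using sub B C by blast
    qed
    then have "B = C"
      by blast
    then show "B \<in> p"
      using C(1) by simp
  qed
  then show ?thesis
    using assms by blast
qed

text \<open>The parts are the sets of positions that carry a common letter.\<close>

lemma ex_represented_partition:
  assumes "length r = n" "card (set r) = k"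
  shows "\<exists>p\<in>k_partitions n k. represents n r p"
proof -
  define B where "B c = {i\<in>{1..n}. r ! (i - 1) = c}" for c
  have ne: "\<exists>i. i \<in> B c" if c: "c \<in> set r" for c
  proof -
    obtain i where "i < n" "r ! i = c"
      using c assms(1) by (auto simp: in_set_conv_nth)
    then have "Suc i \<in> B c"
      by (auto simp: B_def)
    then show ?thesis ..
  qed
  have mem: "r ! (i - 1) \<in> set r" if "i \<in> {1..n}" for i
    using that assms(1) by auto
  have "inj_on B (set r)"
  proof (rule inj_onI)
    fix c d assume *: "c \<in> set r" "B c = B d"
    obtain i where "i \<in> B c"
      using ne[OF *(1)] ..
    moreover from this have "i \<in> B d"
      by (simp only: *(2))
    ultimately show "c = d"
      by (simp add: B_def)
  qed
  then have "card (B ` set r) = k"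
    using assms(2) by (simp add: card_image)
  moreover have "partition_on {1..n} (B ` set r)"
    unfolding partition_on_def disjoint_def
  proof (intro conjI)
    show "\<Union> (B ` set r) = {1..n}"
      using mem unfolding B_def by blast
    show "\<forall>C\<in>B ` set r. \<forall>D\<in>B ` set r. C \<noteq> D \<longrightarrow> C \<inter> D = {}"
      by (fastforce simp: B_def)
    show "{} \<notin> B ` set r"
      using ne by blast
  qed
  moreover have "represents n r (B ` set r)"
    unfolding represents_def
  proof (intro conjI ballI)
    fix i j assume "i \<in> {1..n}" "j \<in> {1..n}"
    then show "r ! (i - 1) = r ! (j - 1) \<longleftrightarrow> (\<exists>C\<in>B ` set r. i \<in> C \<and> j \<in> C)"
      using mem unfolding B_def by fastforce
  qed (rule assms(1))
  ultimately show ?thesis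
    by (auto simp: k_partitions_def)
qed

lemma represents_relabel:
  assumes "represents n r p" "inj_on f (set r)"
  shows "represents n (map f r) p"
proof -
  have "map f r ! (i - 1) = map f r ! (j - 1) \<longleftrightarrow> r ! (i - 1) = r ! (j - 1)"
    if "i \<in> {1..n}" "j \<in> {1..n}" for i j
  proof -
    have "i - 1 < length r" "j - 1 < length r"
      using that assms(1) by (auto simp: represents_def)
    then show ?thesis
      using inj_on_eq_iff[OF assms(2)] by simp
  qed
  then show ?thesis
    using assms(1) by (simp add: represents_def)
qed

text \<open>Both words have the same pattern of equal letters, so reading \<open>s\<close> at any
  position where \<open>r\<close> has a given letter is well defined and injective.\<close>

lemma represents_relabelling:
  assumes "represents n r p" "represents n s p"
  obtains f where "inj_on f (set r)" "s = map f r"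
proof -
  have len: "length r = n" "length s = n"
    using assms by (auto simp: represents_def)
  have eq: "r ! i = r ! j \<longleftrightarrow> s ! i = s ! j" if "i < n" "j < n" for i j
    using represents_nth_eq_iff[OF assms(1) that] represents_nth_eq_iff[OF assms(2) that] by simp
  define f where "f c = s ! (SOME i. i < n \<and> r ! i = c)" for c
  have f: "f (r ! i) = s ! i" if "i < n" for i
  proof -
    have "(SOME j. j < n \<and> r ! j = r ! i) < n \<and> r ! (SOME j. j < n \<and> r ! j = r ! i) = r ! i"
      by (rule someI [of _ i]) (use that in simp)
    then show ?thesis
      unfolding f_def using eq that by blast
  qed
  have "inj_on f (set r)"
  proof (rule inj_onI)
    fix c d assume "c \<in> set r" "d \<in> set r" "f c = f d"
    moreover from this obtain i j where "i < n" "c = r ! i" "j < n" "d = r ! j"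
      unfolding in_set_conv_nth len by blast
    ultimately show "c = d"
      using eq f by simp
  qed
  moreover have "s = map f r"
  proof (rule nth_equalityI)
    show "length s = length (map f r)"
      by (simp add: len)
    show "s ! i = map f r ! i" if "i < length s" for i
      using f that len by simp
  qed
  ultimately show thesis
    using that by blast
qed

text \<open>Number the finitely many parts and write at each position the number of its
  part.\<close>

lemma ex_representing_word:
  assumes "partition_on {1..n} p"
  shows "\<exists>r. represents n r p"
proof -
  have fin: "finite p"
    using assms by (metis finite_atLeastAtMost finite_elements)
  then obtain g :: "nat set \<Rightarrow> nat" where g: "inj_on g p"
    using finite_imp_inj_to_nat_seg[OF fin] by blast
  define b where "b i = (THE B. B \<in> p \<and> i \<in> B)" for i
  have ex1: "\<exists>!B. B \<in> p \<and> i \<in> B" if "i \<in> {1..n}" for i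
    using partition_on_same_part[OF assms] partition_onD1[OF assms] that by blast
  have b: "b i \<in> p \<and> i \<in> b i" if "i \<in> {1..n}" for i
    unfolding b_def by (rule theI' [OF ex1 [OF that]])
  have "represents n (map (\<lambda>i. g (b (Suc i))) [0..<n]) p"
    unfolding represents_def
  proof (intro conjI ballI)
    fix i j assume ij: "i \<in> {1..n}" "j \<in> {1..n}"
    have "g (b i) = g (b j) \<longleftrightarrow> b i = b j"
      using b ij inj_on_eq_iff[OF g] by blast
    also have "\<dots> \<longleftrightarrow> (\<exists>B\<in>p. i \<in> B \<and> j \<in> B)"
      using b[OF ij(1)] b[OF ij(2)] ex1[OF ij(1)] ex1[OF ij(2)] by metis
    finally have "g (b i) = g (b j) \<longleftrightarrow> (\<exists>B\<in>p. i \<in> B \<and> j \<in> B)" .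
    moreover have "i - 1 < n" "Suc (i - 1) = i" "j - 1 < n" "Suc (j - 1) = j"
      using ij by auto
    ultimately show "map (\<lambda>i. g (b (Suc i))) [0..<n] ! (i - 1) =
          map (\<lambda>i. g (b (Suc i))) [0..<n] ! (j - 1) \<longleftrightarrow> (\<exists>B\<in>p. i \<in> B \<and> j \<in> B)"
      by (simp del: One_nat_def)
  qed simp
  then show ?thesis ..
qed

text \<open>Restricted growth words are normal forms: every representing word can be renamed into
  one, and two of them for the same partition are renamings of each other, hence equal.\<close>

lemma ex1_rgf_representing:
  assumes "p \<in> k_partitions n k"
  shows "\<exists>!u. u \<in> rgf n k \<and> represents n (rev u) p"
proof (rule ex_ex1I)
  obtain r where r: "represents n r p"
    using assms ex_representing_word by (auto simp: k_partitions_def)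
  obtain f where f: "inj_on f (set r)"
      "map f (rev r) \<in> rgf (length r) (card (set r))"
    using ex_rgf_relabelling[of "rev r"] by auto
  moreover have "length r = n" "card (set r) = k"
    using r represents_card_set[OF assms r] by (auto simp: represents_def)
  moreover have "represents n (rev (map f (rev r))) p"
    using represents_relabel[OF r f(1)] by (simp add: rev_map [symmetric])
  ultimately show "\<exists>u. u \<in> rgf n k \<and> represents n (rev u) p"
    by blast
next
  fix u v assume uv: "u \<in> rgf n k \<and> represents n (rev u) p" "v \<in> rgf n k \<and> represents n (rev v) p"
  then obtain f where "inj_on f (set (rev u))" "rev v = map f (rev u)"
    using represents_relabelling by metis
  then have "inj_on f (set u)" "v = map f u"
    by (auto simp: rev_map [symmetric])
  then show "u = v"
    using rgf_relabelling_unique uv by metis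
qed

definition rgf_of :: "nat \<Rightarrow> nat \<Rightarrow> nat set set \<Rightarrow> nat list" where
  "rgf_of n k p = (THE u. u \<in> rgf n k \<and> represents n (rev u) p)"

lemma rgf_of:
  assumes "p \<in> k_partitions n k"
  shows "rgf_of n k p \<in> rgf n k" "represents n (rev (rgf_of n k p)) p"
  using theI' [OF ex1_rgf_representing [OF assms]] by (auto simp: rgf_of_def)

lemma bij_betw_rgf_of: "bij_betw (rgf_of n k) (k_partitions n k) (rgf n k)"
  unfolding bij_betw_def
proof
  show "inj_on (rgf_of n k) (k_partitions n k)"
  proof (rule inj_onI)
    fix p q assume *: "p \<in> k_partitions n k" "q \<in> k_partitions n k" "rgf_of n k p = rgf_of n k q"
    then show "p = q"
      using rgf_of(2) represents_unique_partition[of n p q "rev (rgf_of n k p)"]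
      by (metis (no_types, lifting) k_partitions_def mem_Collect_eq)
  qed
  show "rgf_of n k ` k_partitions n k = rgf n k"
  proof (intro equalityI subsetI)
    fix u assume u: "u \<in> rgf n k"
    then have "length (rev u) = n" "card (set (rev u)) = k"
      using rgf_length_set by fastforce+
    then obtain p where p: "p \<in> k_partitions n k" "represents n (rev u) p"
      using ex_represented_partition by blast
    then have "rgf_of n k p = u"
      using ex1_rgf_representing[OF p(1)] rgf_of[OF p(1)] u by blast
    then show "u \<in> rgf_of n k ` k_partitions n k"
      using p by blast
  qed (use rgf_of in auto)
qed

lemma S_eq_Stirling: "S n k = Stirling n k"
  using bij_betw_same_card[OF bij_betw_rgf_of] by (simp add: S_def card_rgf)

section \<open>Recency ranks\<close>

text \<open>This is the position of \<open>x\<close> among the letters of \<open>u\<close> ordered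
  by latest occurrence. If \<open>x\<close> is not in \<open>u\<close>, \<open>takeWhile\<close>
  returns all of \<open>u\<close>, and the rank is the number of letters of
  \<open>u\<close>.\<close>

fun recency_rank :: "'a list \<Rightarrow> nat" where
  "recency_rank [] = 0"
| "recency_rank (x # u) = card (set (takeWhile (\<lambda>y. y \<noteq> x) u))"

text \<open>The rank depends only on which letters are equal, so it can be computed on the
  restricted growth word of a partition instead of on a window.\<close>

lemma recency_rank_map:
  assumes "inj_on f (set v)"
  shows "recency_rank (map f v) = recency_rank v"
proof (cases v)
  case (Cons x u)
  have "takeWhile (\<lambda>y. y \<noteq> f x) (map f u) = map f (takeWhile (\<lambda>y. y \<noteq> x) u)"
    unfolding takeWhile_map comp_def
    by (rule arg_cong [OF takeWhile_cong [OF refl]]) (use assms Cons in \<open>auto simp: inj_on_def\<close>)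
  moreover have "inj_on f (set (takeWhile (\<lambda>y. y \<noteq> x) u))"
    using assms Cons by (auto simp: inj_on_def dest!: set_takeWhileD)
  ultimately show ?thesis
    by (simp add: Cons card_image)
qed simp

lemma takeWhile_neq_notin: "x \<notin> set u \<Longrightarrow> takeWhile (\<lambda>y. y \<noteq> x) u = u"
  by (simp add: takeWhile_eq_all_conv) blast

text \<open>For a window with letter set \<open>{1..k}\<close>, reversed, this is the permutation
  whose sign is followed around the cycle.\<close>

fun recency_list :: "'a list \<Rightarrow> 'a list" where
  "recency_list [] = []"
| "recency_list (x # u) = x # filter (\<lambda>y. y \<noteq> x) (recency_list u)"

lemma set_recency_list [simp]: "set (recency_list u) = set u"
  by (induction u) auto

lemma distinct_recency_list [simp]: "distinct (recency_list u)"
  by (induction u) auto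

lemma length_recency_list: "length (recency_list u) = card (set u)"
  by (metis distinct_card distinct_recency_list set_recency_list)

text \<open>The oldest letter \<open>y\<close> counts only if it does not recur, and then it is the
  least recent one.\<close>

lemma recency_list_snoc:
  "recency_list (u @ [y]) = recency_list u @ (if y \<in> set u then [] else [y])"
  by (induction u) auto

lemma takeWhile_filter_neq:
  "y \<noteq> x \<Longrightarrow> takeWhile (\<lambda>z. z \<noteq> x) (filter (\<lambda>z. z \<noteq> y) l) =
     filter (\<lambda>z. z \<noteq> y) (takeWhile (\<lambda>z. z \<noteq> x) l)"
proof (induction l)
  case (Cons a l)
  then show ?case
    by (cases "a = x"; cases "a = y") simp_all
qed simp

lemma takeWhile_recency_list:
  "takeWhile (\<lambda>y. y \<noteq> x) (recency_list u) = recency_list (takeWhile (\<lambda>y. y \<noteq> x) u)"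
  by (induction u) (auto simp: takeWhile_filter_neq)

lemma recency_rank_Cons:
  "recency_rank (x # u) = length (takeWhile (\<lambda>y. y \<noteq> x) (recency_list u))"
  by (simp add: takeWhile_recency_list length_recency_list)

text \<open>In a distinct list the summand is the index of \<open>x\<close>, so each index below the
  length occurs once.\<close>

lemma sum_length_takeWhile_neq:
  "distinct l \<Longrightarrow> (\<Sum>x\<in>set l. length (takeWhile (\<lambda>y. y \<noteq> x) l)) = \<Sum>{..<length l}"
proof (induction l)
  case (Cons z l)
  have "(\<Sum>x\<in>set (z # l). length (takeWhile (\<lambda>y. y \<noteq> x) (z # l))) =
      (\<Sum>x\<in>set l. length (takeWhile (\<lambda>y. y \<noteq> x) (z # l)))"
    using Cons.prems by simp
  also have "\<dots> = (\<Sum>x\<in>set l. Suc (length (takeWhile (\<lambda>y. y \<noteq> x) l)))"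
    using Cons.prems by (intro sum.cong) auto
  also have "\<dots> = \<Sum>{..<length l} + length l"
    using Cons by (simp add: sum.distrib distinct_card sum_Suc)
  finally show ?case
    by (simp add: lessThan_Suc)
qed simp

text \<open>Over a tail with all \<open>Suc k\<close> letters, the heads run through all positions
  of its recency list; a new head comes after \<open>k\<close> letters and has rank
  \<open>k\<close>.\<close>

lemma sum_recency_rank_rgf:
  "sum recency_rank (rgf (Suc n) (Suc k)) = \<Sum>{..k} * Stirling n (Suc k) + k * Stirling n k"
proof -
  have "(\<Sum>x<Suc k. recency_rank (x # u)) = \<Sum>{..k}" if "u \<in> rgf n (Suc k)" for u
  proof -
    have s: "set u = {..<Suc k}"
      using that rgf_length_set by blast
    then show ?thesis
      using sum_length_takeWhile_neq[of "recency_list u"]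
      by (simp add: recency_rank_Cons length_recency_list lessThan_Suc_atMost
          del: recency_rank.simps)
  qed
  moreover have "recency_rank (k # u) = k" if "u \<in> rgf n k" for u
    using rgf_length_set[OF that] by (simp add: takeWhile_neq_notin)
  ultimately show ?thesis
    unfolding sum_rgf_Suc by (simp add: card_rgf mult.commute)
qed

section \<open>Moving a letter to the front\<close>

text \<open>Its parity encodes the sign of a permutation given as a list.\<close>

fun inversions :: "nat list \<Rightarrow> nat" where
  "inversions [] = 0"
| "inversions (x # l) = length (filter (\<lambda>y. y < x) l) + inversions l"

text \<open>Only the pairs of \<open>x\<close> with a letter of \<open>p\<close> change their order,
  and each of them is an inversion in exactly one of the two lists.\<close>

lemma inversions_move_to_front:
  "x \<notin> set p \<Longrightarrow> even (inversions (p @ x # q) + inversions (x # p @ q) + length p)"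
  by (induction p) auto

text \<open>Read \<open>u @ [y]\<close> and \<open>x # u\<close> as consecutive windows, newest
  letter first: \<open>y\<close> leaves and \<open>x\<close> enters.\<close>

lemma recency_list_step:
  assumes "set (x # u) = A" "set (u @ [y]) = A"
  shows "recency_list (x # u) = x # filter (\<lambda>z. z \<noteq> x) (recency_list (u @ [y]))"
    and "recency_rank (x # u) = length (takeWhile (\<lambda>z. z \<noteq> x) (recency_list (u @ [y])))"
proof -
  \<comment> \<open>If \<open>y\<close> does not occur in \<open>u\<close>, the equal letter sets
    force \<open>y = x\<close>.\<close>
  have *: "recency_list (u @ [y]) = recency_list u \<or>
      recency_list (u @ [y]) = recency_list u @ [x] \<and> x \<notin> set u"
    using assms by (auto simp: recency_list_snoc)
  then show "recency_list (x # u) = x # filter (\<lambda>z. z \<noteq> x) (recency_list (u @ [y]))"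
    by auto
  show "recency_rank (x # u) = length (takeWhile (\<lambda>z. z \<noteq> x) (recency_list (u @ [y])))"
    using * by (auto simp: recency_rank_Cons takeWhile_neq_notin takeWhile_append
        simp del: recency_rank.simps)
qed

text \<open>If the old list is \<open>p @ x # q\<close>, the new one is \<open>x # p @ q\<close> and
  the rank is \<open>length p\<close>.\<close>

lemma even_recency_step:
  assumes "set (x # u) = A" "set (u @ [y]) = A"
  shows "even (inversions (recency_list (u @ [y])) + inversions (recency_list (x # u)) +
    recency_rank (x # u))"
proof -
  let ?l = "recency_list (u @ [y])"
  have "x \<in> set ?l"
    using assms by auto
  then obtain p q where pq: "?l = p @ x # q" "x \<notin> set p"
    by (meson split_list_first)
  then have "takeWhile (\<lambda>z. z \<noteq> x) ?l = p"
    by (simp add: takeWhile_append takeWhile_neq_notin)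
  moreover have "distinct (p @ x # q)"
    by (metis pq(1) distinct_recency_list)
  then have "filter (\<lambda>z. z \<noteq> x) p = p" "filter (\<lambda>z. z \<noteq> x) q = q"
    by (auto simp: filter_id_conv)
  then have "filter (\<lambda>z. z \<noteq> x) ?l = p @ q"
    by (simp add: pq(1))
  ultimately show ?thesis
    using inversions_move_to_front[OF pq(2), of q] recency_list_step[OF assms] pq(1) by simp
qed

text \<open>Telescoping modulo 2: the inner values of \<open>f\<close> cancel, and its two end
  values agree.\<close>

lemma even_sum_if_even_steps:
  fixes f g :: "nat \<Rightarrow> nat"
  assumes "\<And>i. i < N \<Longrightarrow> even (f i + f (Suc i) + g (Suc i))" "f N = f 0" "g N = g 0"
  shows "even (\<Sum>i<N. g i)"
proof -
  have "even (f 0 + f m + (\<Sum>i<m. g (Suc i)))" if "m \<le> N" for m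
    using that
  proof (induction m)
    case (Suc m)
    then show ?case
      using assms(1)[of m] by auto
  qed simp
  from this[of N] have "even (\<Sum>i<N. g (Suc i))"
    using assms(2) by simp
  \<comment> \<open>The steps involve \<open>g\<close> at 1, ..., N; periodicity shifts this to 0,
    ..., N - 1.\<close>
  moreover have "(\<Sum>i<N. g (Suc i)) + g 0 = (\<Sum>i<N. g i) + g N"
    by (metis sum.lessThan_Suc sum.lessThan_Suc_shift add.commute)
  ultimately show ?thesis
    using assms(3) by simp
qed

section \<open>Universal cycles\<close>

text \<open>A window represents at most one partition, so sending a partition to its window is
  injective. There are as many positions as partitions, so every window is reached.\<close>

lemma ucycle_bij_betw:
  assumes "ucycle n k a"
  obtains \<pi> where "bij_betw \<pi> (k_partitions n k) {..<S n k}"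
    "\<And>p. p \<in> k_partitions n k \<Longrightarrow> represents n (window n a (\<pi> p)) p"
proof -
  have "\<forall>p\<in>k_partitions n k. \<exists>i. i < S n k \<and> represents n (window n a i) p"
    using assms by (auto simp: ucycle_def)
  then obtain \<pi> where \<pi>: "\<And>p. p \<in> k_partitions n k \<Longrightarrow> \<pi> p < S n k"
      "\<And>p. p \<in> k_partitions n k \<Longrightarrow> represents n (window n a (\<pi> p)) p"
    by metis
  have "inj_on \<pi> (k_partitions n k)"
  proof (rule inj_onI)
    fix p q assume *: "p \<in> k_partitions n k" "q \<in> k_partitions n k" "\<pi> p = \<pi> q"
    then show "p = q"
      using \<pi>(2) represents_unique_partition[of n p q "window n a (\<pi> p)"]
      by (metis (no_types, lifting) k_partitions_def mem_Collect_eq)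
  qed
  moreover from this have "\<pi> ` k_partitions n k = {..<S n k}"
    using \<pi>(1) by (intro card_subset_eq) (auto simp: card_image S_def)
  ultimately show thesis
    using that \<pi>(2) by (simp add: bij_betw_def)
qed

text \<open>The sum passes from windows to partitions along \<pi>; there each window is an injective
  renaming of the restricted growth word, hence of the same rank.\<close>

lemma ucycle_sum_recency_rank:
  assumes "ucycle n k a"
  shows "(\<Sum>i<S n k. recency_rank (rev (window n a i))) = sum recency_rank (rgf n k)"
proof -
  obtain \<pi> where \<pi>: "bij_betw \<pi> (k_partitions n k) {..<S n k}"
    "\<And>p. p \<in> k_partitions n k \<Longrightarrow> represents n (window n a (\<pi> p)) p"
    using ucycle_bij_betw[OF assms] by blast
  have "(\<Sum>i<S n k. recency_rank (rev (window n a i))) =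
      (\<Sum>p\<in>k_partitions n k. recency_rank (rev (window n a (\<pi> p))))"
    by (rule sum.reindex_bij_betw [OF \<pi>(1), symmetric])
  also have "\<dots> = (\<Sum>p\<in>k_partitions n k. recency_rank (rgf_of n k p))"
  proof (rule sum.cong [OF refl])
    fix p assume p: "p \<in> k_partitions n k"
    obtain f where "inj_on f (set (rev (rgf_of n k p)))"
        "window n a (\<pi> p) = map f (rev (rgf_of n k p))"
      using represents_relabelling[OF rgf_of(2)[OF p] \<pi>(2)[OF p]] .
    then show "recency_rank (rev (window n a (\<pi> p))) = recency_rank (rgf_of n k p)"
      by (simp add: rev_map recency_rank_map)
  qed
  also have "\<dots> = sum recency_rank (rgf n k)"
    by (rule sum.reindex_bij_betw [OF bij_betw_rgf_of])
  finally show ?thesis .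
qed

text \<open>A word for a \<open>k\<close>-partition has \<open>k\<close> distinct letters, which
  exhaust the alphabet.\<close>

lemma ucycle_set_window:
  assumes "ucycle n k a" "i < S n k"
  shows "set (window n a i) = {1..k}"
proof -
  obtain \<pi> where \<pi>: "bij_betw \<pi> (k_partitions n k) {..<S n k}"
    "\<And>p. p \<in> k_partitions n k \<Longrightarrow> represents n (window n a (\<pi> p)) p"
    using ucycle_bij_betw[OF assms(1)] by blast
  obtain p where p: "p \<in> k_partitions n k" "\<pi> p = i"
    using \<pi>(1) assms(2) by (metis bij_betw_imp_surj_on imageE lessThan_iff)
  then have "card (set (window n a i)) = k"
    using represents_card_set \<pi>(2) by blast
  moreover have "length a > 0"
    using assms by (auto simp: ucycle_def)
  then have "set (window n a i) \<subseteq> set a"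
    by (auto simp: window_def)
  then have "set (window n a i) \<subseteq> {1..k}"
    using assms(1) unfolding ucycle_def by blast
  ultimately show ?thesis
    by (intro card_subset_eq) auto
qed

lemma even_sum_recency_rank_windows:
  assumes a: "ucycle (Suc n) k a"
  shows "even (\<Sum>i<S (Suc n) k. recency_rank (rev (window (Suc n) a i)))"
proof -
  let ?N = "S (Suc n) k"
  let ?v = "\<lambda>i. rev (window (Suc n) a i)"
  have N: "length a = ?N"
    using a by (simp add: ucycle_def)
  have wrap: "window (Suc n) a ?N = window (Suc n) a 0"
    by (simp add: window_def flip: N)
  have "even (inversions (recency_list (?v i)) + inversions (recency_list (?v (Suc i))) +
      recency_rank (?v (Suc i)))" if i: "i < ?N" for i
  proof -
    \<comment> \<open>The overlap of the windows at \<open>i\<close> and \<open>Suc i\<close>,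
      newest letter first.\<close>
    let ?u = "rev (map (\<lambda>j. a ! ((Suc i + j) mod length a)) [0..<n])"
    have 1: "?v i = ?u @ [a ! (i mod length a)]"
      unfolding window_def upt_conv_Cons[OF zero_less_Suc]
      by (simp add: map_Suc_upt[symmetric] comp_def del: upt_Suc)
    have 2: "?v (Suc i) = a ! ((Suc i + n) mod length a) # ?u"
      by (simp add: window_def)
    have "set (window (Suc n) a (Suc i)) = {1..k}"
    \<comment> \<open>Position \<open>?N\<close> is out of range for
      \<open>ucycle_set_window\<close>, but its window is the first one again.\<close>
    proof (cases "Suc i = ?N")
      case True
      then show ?thesis
        using wrap ucycle_set_window[OF a, of 0] i by simp
    next
      case False
      then show ?thesis
        using ucycle_set_window[OF a, of "Suc i"] i by simp
    qed
    moreover have "set (window (Suc n) a i) = {1..k}"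
      by (rule ucycle_set_window[OF a i])
    ultimately have "set (?v i) = {1..k}" "set (?v (Suc i)) = {1..k}"
      by simp_all
    then show ?thesis
      unfolding 1 2 by (intro even_recency_step)
  qed
  then show ?thesis
    using wrap
    by (intro even_sum_if_even_steps[where f = "\<lambda>i. inversions (recency_list (?v i))"]) auto
qed

lemma even_Stirling_ucycle:
  assumes "ucycle (Suc n) (Suc k) a"
  shows "even (\<Sum>{..k} * Stirling n (Suc k) + k * Stirling n k)"
  using even_sum_recency_rank_windows[OF assms] ucycle_sum_recency_rank[OF assms]
  by (simp only: sum_recency_rank_rgf)

section \<open>Parity of Stirling numbers\<close>

lemma even_Stirling_Suc_Suc:
  "even (Stirling (Suc n) (Suc k)) \<longleftrightarrow>
     ((odd k \<or> even (Stirling n (Suc k))) \<longleftrightarrow> even (Stirling n k))"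
  by (simp only: Stirling.simps even_add even_mult_iff even_Suc)

text \<open>In the recurrence applied twice, \<open>Stirling m (Suc j)\<close> has the odd
  coefficient (j + 2) + (j + 1), and \<open>Stirling m (Suc (Suc j))\<close> has (j + 2)^2, of the
  parity of \<open>j\<close>.\<close>

lemma even_Stirling_add_2:
  "even (Stirling (Suc (Suc m)) (Suc (Suc j))) \<longleftrightarrow>
     ((even (Stirling m j) \<longleftrightarrow> even (Stirling m (Suc j))) \<longleftrightarrow>
       even j \<or> even (Stirling m (Suc (Suc j))))"
  unfolding even_Stirling_Suc_Suc by auto

text \<open>Induction in steps of two rows. Modulo 2, the new entry at 4t + 3 is the sum of the old
  ones at 4t + 1, 4t + 2 and 4t + 3, even by induction. For t > 0, both other new entries reduce to
  the sum of the old ones at 4t and 4t + 1, as the old entry at 4t - 1 is even.\<close>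

lemma Stirling_even_parity:
  assumes "even m"
  shows "even (Stirling m (4 * t + 3)) \<and>
    (even (Stirling m (4 * t + 1)) \<longleftrightarrow> even (Stirling m (4 * t + 2)))"
proof -
  obtain h where h: "m = 2 * h"
    using assms by blast
  have "even (Stirling (2 * h) (4 * t + 3)) \<and>
    (even (Stirling (2 * h) (4 * t + 1)) \<longleftrightarrow> even (Stirling (2 * h) (4 * t + 2)))" for t
  proof (induction h arbitrary: t)
    case (Suc h)
    have m: "2 * Suc h = Suc (Suc (2 * h))"
      by simp
    have k: "4 * t + 3 = Suc (Suc (4 * t + 1))" "4 * t + 2 = Suc (Suc (4 * t))"
      by simp_all
    have 3: "even (Stirling (2 * Suc h) (4 * t + 3))"
      unfolding m k even_Stirling_add_2 using Suc.IH[of t] by (simp add: k numeral_3_eq_3)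
    show ?case
    proof (cases t)
      case 0
      \<comment> \<open>Exactly one of the two numbers is 1 and the other is 0: the first is 1 if h
        = 0, the second otherwise.\<close>
      have "even (Stirling (2 * h) 0) \<longleftrightarrow> odd (Stirling (2 * h) (Suc 0))"
        by (cases "2 * h") (simp_all del: Stirling.simps(4))
      then have "odd (Stirling (Suc (Suc (2 * h))) (Suc (Suc 0)))"
        unfolding even_Stirling_add_2 by auto
      then show ?thesis
        using 3 by (simp add: 0 numeral_2_eq_2 del: Stirling.simps(4))
    next
      case (Suc s)
      have k': "4 * t + 1 = Suc (Suc (4 * s + 3))" "4 * t = Suc (4 * s + 3)"
        by (simp_all add: Suc)
      have "even (Stirling (2 * Suc h) (4 * t + 1)) \<longleftrightarrow> even (Stirling (2 * Suc h) (4 * t + 2))"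
        unfolding m k k'(1) even_Stirling_add_2 using Suc.IH[of t] Suc.IH[of s]
        by (auto simp: k k' simp del: Stirling.simps(4))
      then show ?thesis
        using 3 by blast
    qed
  qed (simp add: numeral_eq_Suc)
  then show ?thesis
    by (simp add: h)
qed

lemma even_sum_atMost_iff: "even (\<Sum>{..n::nat}) \<longleftrightarrow> n mod 4 = 0 \<or> n mod 4 = 3"
proof (induction n)
  case (Suc n)
  show ?case
    unfolding atMost_Suc using Suc by simp presburger
qed simp

text \<open>Reduce modulo 2 to row \<open>m\<close>. For j = 4t the two summands become S(m,j+1) and
  S(m,j+1) + 1. For j = 4t + 1 the sum becomes S(m,4t+2), odd like S(m,4t+1). For j = 4t + 2 it
  becomes S(m,4t+3) + 1. The case j = 4t + 3 cannot occur, as S(m,4t+3) is even.\<close>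

lemma odd_Stirling_if_even_odd:
  assumes "even m" "odd (Stirling m j)"
  shows "odd (\<Sum>{..Suc j} * Stirling (Suc m) (Suc (Suc j)) + Suc j * Stirling (Suc m) (Suc j))"
proof -
  define t where "t = j div 4"
  have t: "even (Stirling m (4 * t + 3))"
      "even (Stirling m (4 * t + 1)) \<longleftrightarrow> even (Stirling m (4 * t + 2))"
    using Stirling_even_parity[OF assms(1)] by blast+
  have parity: "even (\<Sum>{..Suc j} * Stirling (Suc m) (Suc (Suc j)) +
        Suc j * Stirling (Suc m) (Suc j)) \<longleftrightarrow>
      (even (\<Sum>{..Suc j}) \<or>
        ((even j \<or> even (Stirling m (Suc (Suc j)))) \<longleftrightarrow> even (Stirling m (Suc j)))) =
      (odd j \<or> odd (Stirling m (Suc j)))"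
    using assms(2)
    by (simp only: even_add even_mult_iff even_Suc even_Stirling_Suc_Suc) auto
  have "j = 4 * t \<or> j = 4 * t + 1 \<or> j = 4 * t + 2 \<or> j = 4 * t + 3"
    unfolding t_def by presburger
  then consider "j = 4 * t" | "j = 4 * t + 1" | "j = 4 * t + 2" | "j = 4 * t + 3"
    by blast
  then show ?thesis
  proof cases
    case 1
    have "odd (\<Sum>{..Suc j})"
      unfolding even_sum_atMost_iff 1 by presburger
    then show ?thesis
      unfolding parity using 1 by auto
  next
    case 2
    have "odd (\<Sum>{..Suc j})"
      unfolding even_sum_atMost_iff 2 by presburger
    moreover have "odd (Stirling m (Suc j))" "even (Stirling m (Suc (Suc j)))"
      using assms(2) t by (simp_all add: 2 numeral_eq_Suc)
    ultimately show ?thesis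
      unfolding parity using 2 by auto
  next
    case 3
    have "even (\<Sum>{..Suc j})"
      unfolding even_sum_atMost_iff 3 by presburger
    moreover have "even (Stirling m (Suc j))"
      using t by (simp add: 3 numeral_eq_Suc)
    ultimately show ?thesis
      unfolding parity using 3 by auto
  next
    case 4
    then show ?thesis
      using assms(2) t by simp
  qed
qed

theorem corollary19:
  fixes n k :: nat
  assumes "2 \<le> k" and "k < n"
    and "even n" and "odd (S (n - 2) (k - 2))"
  shows "\<not> (\<exists>a. ucycle n k a)"
proof
  assume "\<exists>a. ucycle n k a"
  then obtain a where a: "ucycle n k a" ..
  obtain m j where mj: "n = Suc (Suc m)" "k = Suc (Suc j)"
    using assms(1,2) by (metis Suc_le_D less_trans_Suc less_natE le_less_trans numeral_2_eq_2
        Suc_le_lessD less_imp_Suc_add add_Suc)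
  have "even m" "odd (Stirling m j)"
    using assms(3,4) by (simp_all add: mj S_eq_Stirling)
  \<comment> \<open>The same sum of ranks is odd by arithmetic and even by going around the
    cycle.\<close>
  then show False
    using odd_Stirling_if_even_odd even_Stirling_ucycle[OF a[unfolded mj]] by blast
qed

end
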